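(* Let $R=\mathbb Z[u_{s,i}^{\pm1},u_{t,j}^{\pm1},u_{u,l}^{\pm1}]_{1\le i\le 2,\,1\le j,l\le 3}$ and let $$H_{G_7}=\Big\langle s,t,u\ \Big|\ stu=tus=ust,\ \prod_{i=1}^2(s-u_{s,i})=\prod_{j=1}^3(t-u_{t,j})=\prod_{l=1}^3(u-u_{u,l})=0\Big\rangle$$ be the generic Hecke algebra (an associative unital $R$-algebra) of $G_7$. Let $u_2,u_3$ be the $R$-subalgebras generated by $t$ and by $u$ respectively, let $z=stu$, and let $$U=\sum_{k=0}^{11}\big(z^ku_3u_2+z^ktu^{-1}u_2\big).$$ Then $H_{G_7}=U$.
   Context: For subsets $X,Y$ of an $R$-algebra, $XY$ denotes the $R$-submodule spanned by the products $xy$. The generators are invertible in the algebra because the parameters are invertible in $R$. *)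

theory Defs
  imports Complex_Main "HOL-Library.Poly_Mapping" "HOL-Library.Set_Algebras"
begin

section \<open>The ring of parameters\<close>

text \<open>
  The Laurent polynomial ring over the integers in the eight parameters is the group ring of the
  free abelian group on the parameters: exponent vectors are finitely supported integer-valued
  functions, and a Laurent polynomial is a finitely supported family of integer coefficients.
\<close>

datatype param = Us1 | Us2 | Ut1 | Ut2 | Ut3 | Uu1 | Uu2 | Uu3

type_synonym laurent = "(param \<Rightarrow>\<^sub>0 int) \<Rightarrow>\<^sub>0 int"

definition par :: "param \<Rightarrow> laurent" where
  "par p = Poly_Mapping.single (Poly_Mapping.single p 1) 1"

definition par_inv :: "param \<Rightarrow> laurent" where
  "par_inv p = Poly_Mapping.single (Poly_Mapping.single p (- 1)) 1"

lemma par_mult_par_inv: "par p * par_inv p = 1"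
  by (simp add: par_def par_inv_def mult_single flip: single_add)


section \<open>The free associative algebra on three generators\<close>

datatype gen = GenS | GenT | GenU

text \<open>
  The free monoid on the generators, written additively because the convolution product of
  finitely supported functions is defined for additive monoids.
\<close>

datatype gword = GWord "gen list"

instantiation gword :: monoid_add
begin

definition zero_gword :: gword where "zero_gword = GWord []"

fun plus_gword :: "gword \<Rightarrow> gword \<Rightarrow> gword" where
  "plus_gword (GWord v) (GWord w) = GWord (v @ w)"

instance
proof
  fix a b c :: gword
  show "a + b + c = a + (b + c)"
    by (cases a; cases b; cases c) simp
  show "0 + a = a" by (cases a) (simp add: zero_gword_def)
  show "a + 0 = a" by (cases a) (simp add: zero_gword_def)
qed

end

type_synonym free_alg = "gword \<Rightarrow>\<^sub>0 laurent"

definition fgen :: "gen \<Rightarrow> free_alg" where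
  "fgen g = Poly_Mapping.single (GWord [g]) 1"

definition fconst :: "laurent \<Rightarrow> free_alg" where
  "fconst c = Poly_Mapping.single 0 c"

lemma fconst_add: "fconst (a + b) = fconst a + fconst b"
  by (simp add: fconst_def single_add)

lemma fconst_mult: "fconst (a * b) = fconst a * fconst b"
  by (simp add: fconst_def mult_single)

lemma fconst_one: "fconst 1 = 1"
  by (simp add: fconst_def)

lemma poly_mapping_add_induct [case_names zero add]:
  fixes f :: "'a \<Rightarrow>\<^sub>0 'b::monoid_add"
  assumes "P 0" and "\<And>f k v. P f \<Longrightarrow> P (f + Poly_Mapping.single k v)"
  shows "P f"
proof (induction f rule: update_induct)
  case const
  then show ?case by (rule assms(1))
next
  case (update f a b)
  have "Poly_Mapping.update a b f = f + Poly_Mapping.single a b"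
    using update by (intro poly_mapping_eqI)
      (auto simp: lookup_update lookup_add lookup_single when_def in_keys_iff)
  then show ?case using assms(2) update by simp
qed

lemma fconst_central: "fconst c * f = f * fconst c"
  by (induction f rule: poly_mapping_add_induct)
    (simp_all add: fconst_def distrib_left distrib_right mult_single mult.commute)


section \<open>The generic Hecke algebra\<close>

definition hecke_relators :: "free_alg set" where
  "hecke_relators = (let s = fgen GenS; t = fgen GenT; u = fgen GenU; c = (\<lambda>p. fconst (par p)) in
     {s * t * u - t * u * s,
      t * u * s - u * s * t,
      (s - c Us1) * (s - c Us2),
      (t - c Ut1) * (t - c Ut2) * (t - c Ut3),
      (u - c Uu1) * (u - c Uu2) * (u - c Uu3)})"

text \<open>The two-sided ideal generated by the relators.\<close>

inductive_set hecke_ideal :: "free_alg set" where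
  relator: "r \<in> hecke_relators \<Longrightarrow> r \<in> hecke_ideal"
| zero: "0 \<in> hecke_ideal"
| add: "a \<in> hecke_ideal \<Longrightarrow> b \<in> hecke_ideal \<Longrightarrow> a + b \<in> hecke_ideal"
| mult_left: "a \<in> hecke_ideal \<Longrightarrow> x * a \<in> hecke_ideal"
| mult_right: "a \<in> hecke_ideal \<Longrightarrow> a * x \<in> hecke_ideal"

lemma hecke_ideal_uminus: "a \<in> hecke_ideal \<Longrightarrow> - a \<in> hecke_ideal"
  using hecke_ideal.mult_left[of a "- 1"] by simp

text \<open>
  The ideal is proper: the one-dimensional character sending each generator to its first
  parameter vanishes on it. This is needed to make the quotient an instance of \<open>ring_1\<close>.
\<close>

fun gval :: "gen \<Rightarrow> laurent" where
  "gval GenS = par Us1"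
| "gval GenT = par Ut1"
| "gval GenU = par Uu1"

fun wval :: "gword \<Rightarrow> laurent" where
  "wval (GWord w) = prod_list (map gval w)"

definition fval :: "free_alg \<Rightarrow> laurent" where
  "fval f = (\<Sum>w\<in>Poly_Mapping.keys f. Poly_Mapping.lookup f w * wval w)"

lemma wval_add: "wval (v + w) = wval v * wval w"
  by (cases v; cases w) simp

lemma fval_add: "fval (f + g) = fval f + fval g"
  unfolding fval_def
  by (rule setsum_keys_plus_distrib) (simp_all add: distrib_right)

lemma fval_single: "fval (Poly_Mapping.single w c) = c * wval w"
  by (simp add: fval_def)

lemma fval_zero: "fval 0 = 0"
  by (simp add: fval_def)

lemma fval_mult: "fval (f * g) = fval f * fval g"
proof (induction f rule: poly_mapping_add_induct)
  case zero
  then show ?case by (simp add: fval_zero)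
next
  case (add f k v)
  have "fval (Poly_Mapping.single k v * g) = fval (Poly_Mapping.single k v) * fval g"
    by (induction g rule: poly_mapping_add_induct)
      (simp_all add: fval_zero distrib_left fval_add mult_single fval_single wval_add ac_simps)
  with add show ?case by (simp add: distrib_right fval_add)
qed

lemma fval_diff: "fval (f - g) = fval f - fval g"
  using fval_add[of "f - g" g] by (simp add: eq_diff_eq)

lemma fval_fgen: "fval (fgen g) = gval g"
  by (simp add: fgen_def fval_single)

lemma fval_fconst: "fval (fconst c) = c"
  by (simp add: fconst_def fval_single zero_gword_def)

lemma fval_hecke_ideal: "a \<in> hecke_ideal \<Longrightarrow> fval a = 0"
proof (induction rule: hecke_ideal.induct)
  case (relator r)
  then show ?case
    by (auto simp: hecke_relators_def Let_def fval_mult fval_diff fval_fgen fval_fconst ac_simps)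
qed (simp_all add: fval_zero fval_add fval_mult)

definition hecke_rel :: "free_alg \<Rightarrow> free_alg \<Rightarrow> bool" where
  "hecke_rel a b \<longleftrightarrow> a - b \<in> hecke_ideal"

lemma equivp_hecke_rel: "equivp hecke_rel"
proof (rule equivpI)
  show "reflp hecke_rel"
    by (auto simp: reflp_def hecke_rel_def intro: hecke_ideal.zero)
  show "symp hecke_rel"
    unfolding symp_def hecke_rel_def using hecke_ideal_uminus by fastforce
  show "transp hecke_rel"
    unfolding transp_def hecke_rel_def using hecke_ideal.add by fastforce
qed

quotient_type hecke_G7 = free_alg / hecke_rel
  by (rule equivp_hecke_rel)

instantiation hecke_G7 :: ring_1
begin

lift_definition zero_hecke_G7 :: hecke_G7 is 0 .

lift_definition one_hecke_G7 :: hecke_G7 is 1 .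

lift_definition plus_hecke_G7 :: "hecke_G7 \<Rightarrow> hecke_G7 \<Rightarrow> hecke_G7" is "(+)"
  unfolding hecke_rel_def using hecke_ideal.add by (fastforce simp: algebra_simps)

lift_definition uminus_hecke_G7 :: "hecke_G7 \<Rightarrow> hecke_G7" is uminus
  unfolding hecke_rel_def using hecke_ideal_uminus by fastforce

lift_definition minus_hecke_G7 :: "hecke_G7 \<Rightarrow> hecke_G7 \<Rightarrow> hecke_G7" is "(-)"
proof -
  fix a b c d assume "hecke_rel a b" "hecke_rel c d"
  then have "(a - b) + - (c - d) \<in> hecke_ideal"
    unfolding hecke_rel_def by (intro hecke_ideal.add hecke_ideal_uminus)
  then show "hecke_rel (a - c) (b - d)" by (simp add: hecke_rel_def algebra_simps)
qed

lift_definition times_hecke_G7 :: "hecke_G7 \<Rightarrow> hecke_G7 \<Rightarrow> hecke_G7" is "(*)"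
proof -
  fix a b c d assume "hecke_rel a b" "hecke_rel c d"
  then have "(a - b) * c + b * (c - d) \<in> hecke_ideal"
    unfolding hecke_rel_def
    by (intro hecke_ideal.add hecke_ideal.mult_left hecke_ideal.mult_right)
  then show "hecke_rel (a * c) (b * d)" by (simp add: hecke_rel_def algebra_simps)
qed

instance
proof
  show "(0::hecke_G7) \<noteq> 1"
  proof transfer
    have "fval (0 - 1) \<noteq> 0"
      using fval_fconst[of 1] fval_diff[of 0 1] by (simp add: fval_zero fconst_one)
    then show "\<not> hecke_rel 0 1"
      unfolding hecke_rel_def using fval_hecke_ideal by blast
  qed
qed (transfer; simp add: hecke_rel_def algebra_simps hecke_ideal.zero)+

end

lift_definition hecke_scale :: "laurent \<Rightarrow> hecke_G7 \<Rightarrow> hecke_G7" is "\<lambda>c f. fconst c * f"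
  unfolding hecke_rel_def using hecke_ideal.mult_left by (fastforce simp flip: right_diff_distrib)

interpretation hecke: module hecke_scale
  by standard (transfer; simp add: hecke_rel_def algebra_simps fconst_add fconst_mult fconst_one
      hecke_ideal.zero)+

lemma hecke_scale_mult_left: "hecke_scale c x * y = hecke_scale c (x * y)"
  by transfer (simp add: hecke_rel_def mult.assoc hecke_ideal.zero)

lemma hecke_scale_mult_right: "x * hecke_scale c y = hecke_scale c (x * y)"
proof transfer
  fix x c y
  have "x * (fconst c * y) = fconst c * (x * y)"
    by (metis fconst_central mult.assoc)
  then show "hecke_rel (x * (fconst c * y)) (fconst c * (x * y))"
    by (simp add: hecke_rel_def hecke_ideal.zero)
qed

lift_definition hs :: hecke_G7 is "fgen GenS" .
lift_definition ht :: hecke_G7 is "fgen GenT" .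
lift_definition hu :: hecke_G7 is "fgen GenU" .

abbreviation hpar :: "param \<Rightarrow> hecke_G7" where
  "hpar p \<equiv> hecke_scale (par p) 1"

lemma hecke_relations:
  "hs * ht * hu = ht * hu * hs"
  "ht * hu * hs = hu * hs * ht"
  "(hs - hpar Us1) * (hs - hpar Us2) = 0"
  "(ht - hpar Ut1) * (ht - hpar Ut2) * (ht - hpar Ut3) = 0"
  "(hu - hpar Uu1) * (hu - hpar Uu2) * (hu - hpar Uu3) = 0"
  by (transfer; auto simp: hecke_rel_def hecke_relators_def Let_def intro!: hecke_ideal.relator)+


section \<open>Submodules, subalgebras and inverses\<close>

text \<open>
  The submodule product of two subsets. The product \<open>X * Y\<close> of \<open>HOL-Library.Set_Algebras\<close> is
  only the set of products; its span is taken here. Sums of submodules are the elementwise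
  sums of that theory.
\<close>

definition span_mult :: "hecke_G7 set \<Rightarrow> hecke_G7 set \<Rightarrow> hecke_G7 set"  (infixl \<open>\<cdot>\<^sub>R\<close> 70) where
  "X \<cdot>\<^sub>R Y = hecke.span (X * Y)"

definition is_subalgebra :: "hecke_G7 set \<Rightarrow> bool" where
  "is_subalgebra A \<longleftrightarrow> hecke.subspace A \<and> 1 \<in> A \<and> (\<forall>x\<in>A. \<forall>y\<in>A. x * y \<in> A)"

definition subalgebra_u2 :: "hecke_G7 set" where
  "subalgebra_u2 = is_subalgebra hull {ht}"

definition subalgebra_u3 :: "hecke_G7 set" where
  "subalgebra_u3 = is_subalgebra hull {hu}"

definition minverse :: "'a::monoid_mult \<Rightarrow> 'a" where
  "minverse x = (THE y. x * y = 1 \<and> y * x = 1)"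

lemma minverse_eqI:
  assumes "x * y = 1" "y * x = 1"
  shows "minverse x = y"
  unfolding minverse_def
  by (rule the_equality) (use assms in \<open>auto, metis mult.assoc mult_1_left mult_1_right\<close>)

lemma cubic_inverse:
  fixes x :: hecke_G7
  assumes "(x - hpar p) * (x - hpar q) * (x - hpar r) = 0"
  shows "\<exists>y. x * y = 1 \<and> y * x = 1"
proof -
  let ?s = hecke_scale
  let ?a = "par p" and ?b = "par q" and ?c = "par r"
  let ?w = "x * x - ?s (?a + ?b + ?c) x + ?s (?a * ?b + ?a * ?c + ?b * ?c) 1"
  let ?i = "par_inv p * par_inv q * par_inv r"
  have eq: "(x - hpar p) * (x - hpar q) * (x - hpar r) = x * ?w - ?s (?a * ?b * ?c) 1"
    and comm: "x * ?w = ?w * x"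
    by (simp_all add: algebra_simps hecke_scale_mult_left hecke_scale_mult_right
        hecke.scale_right_diff_distrib hecke.scale_right_distrib hecke.scale_left_distrib)
  have "?i * (?a * ?b * ?c) = (par p * par_inv p) * (par q * par_inv q) * (par r * par_inv r)"
    by (simp only: ac_simps)
  then have i: "?i * (?a * ?b * ?c) = 1" by (simp add: par_mult_par_inv)
  have xw: "x * ?w = ?s (?a * ?b * ?c) 1" using assms eq by simp
  have "x * ?s ?i ?w = ?s ?i (x * ?w)" by (rule hecke_scale_mult_right)
  also have "\<dots> = 1" unfolding xw by (simp only: hecke.scale_scale i hecke.scale_one)
  finally have 1: "x * ?s ?i ?w = 1" .
  have "?s ?i ?w * x = ?s ?i (?w * x)" by (rule hecke_scale_mult_left)
  also have "\<dots> = 1" unfolding comm[symmetric] xw by (simp only: hecke.scale_scale i hecke.scale_one)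
  finally show ?thesis using 1 by blast
qed

lemma hu_inverse: "hu * minverse hu = 1" "minverse hu * hu = 1"
proof -
  obtain y where y: "hu * y = 1" "y * hu = 1"
    using cubic_inverse[OF hecke_relations(5)] by blast
  then have "minverse hu = y" by (rule minverse_eqI)
  with y show "hu * minverse hu = 1" "minverse hu * hu = 1" by auto
qed

definition hz :: hecke_G7 where
  "hz = hs * ht * hu"

end

theory Submission
  imports Defs
begin

text \<open>
  Write \<open>s, t, u, z\<close> for \<open>hs, ht, hu, hz\<close>. Since \<open>z\<close> is central and \<open>s = z u\<^sup>-\<^sup>1 t\<^sup>-\<^sup>1\<close>, the quadratic
  relation \<open>s\<^sup>2 = (a + b) s - a b\<close> becomes \<open>z\<^sup>2 u\<^sup>-\<^sup>1 t\<^sup>-\<^sup>1 = (a + b) z - a b t u\<close>, whose first and last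
  coefficients are units; so are those of the cubic relations of \<open>t\<close> and \<open>u\<close>. Multiplying such a
  relation by words on both sides and by a power of \<open>z\<close> puts one of its extreme monomials into
  the right \<open>u\<^sub>2\<close>-module \<open>U\<close> as soon as all its other monomials lie there. Repeating this shows that
  \<open>z\<^sup>k t u\<close>, \<open>z\<^sup>k t\<^sup>-\<^sup>1 u\<^sup>-\<^sup>1\<close> and \<open>z\<^sup>k u t u\<^sup>-\<^sup>1\<close> lie in \<open>U\<close> for all \<open>0 \<le> k \<le> 11\<close>, which makes \<open>U\<close> stable
  under left multiplication by \<open>t\<close> and \<open>u\<close>. The relation then also gives \<open>z\<^sup>1\<^sup>2 \<in> U\<close>, so \<open>U\<close> is stable
  under \<open>z\<close> and hence under \<open>s\<close>.
\<close>

abbreviation hti :: hecke_G7 where "hti \<equiv> minverse ht"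
abbreviation hui :: hecke_G7 where "hui \<equiv> minverse hu"

definition hecke_U :: "hecke_G7 set" where
  "hecke_U =
    (\<Sum>k = 0..(11::nat).
        {hz ^ k} \<cdot>\<^sub>R subalgebra_u3 \<cdot>\<^sub>R subalgebra_u2
      + {hz ^ k * ht * minverse hu} \<cdot>\<^sub>R subalgebra_u2)"


section \<open>Relations in the Hecke algebra\<close>

lemma hecke_inverse:
  assumes "(x - hpar p) * (x - hpar q) * (x - hpar r) = 0"
  shows "x * minverse x = 1" "minverse x * x = 1"
  using cubic_inverse[OF assms] minverse_eqI by blast+

lemmas ht_inverse = hecke_inverse[OF hecke_relations(4)]

text \<open>The inverse laws for right-nested products: with associativity they let simp cancel
  inside words.\<close>

lemma inverse_cancel_left:
  "ht * (hti * x) = x" "hti * (ht * x) = x" "hu * (hui * x) = x" "hui * (hu * x) = x"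
  by (simp_all add: ht_inverse hu_inverse flip: mult.assoc)

lemmas word_simps = mult.assoc ht_inverse hu_inverse inverse_cancel_left

text \<open>Every element is an \<open>R\<close>-combination of words, and words arise by prepending
  generators. This reduces the theorem to \<open>1 \<in> hecke_U\<close> and stability of
  \<open>hecke_U\<close> under left multiplication by \<open>s\<close>, \<open>t\<close>,
  \<open>u\<close>.\<close>

lemma hecke_left_induct:
  assumes V: "hecke.subspace V" and one: "1 \<in> V"
    and step: "\<And>x. x \<in> V \<Longrightarrow> hs * x \<in> V" "\<And>x. x \<in> V \<Longrightarrow> ht * x \<in> V" "\<And>x. x \<in> V \<Longrightarrow> hu * x \<in> V"
  shows "V = UNIV"
proof -
  have word: "abs_hecke_G7 (Poly_Mapping.single (GWord w) 1) \<in> V" for w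
  proof (induction w)
    case Nil
    then show ?case using one by (simp add: one_hecke_G7_def flip: zero_gword_def)
  next
    case (Cons g w)
    have "abs_hecke_G7 (Poly_Mapping.single (GWord (g # w)) 1) =
        abs_hecke_G7 (fgen g) * abs_hecke_G7 (Poly_Mapping.single (GWord w) 1)"
      by (simp add: times_hecke_G7.abs_eq fgen_def mult_single)
    with Cons step show ?case by (cases g) (simp_all flip: hs_def ht_def hu_def)
  qed
  have "abs_hecke_G7 f \<in> V" for f
  proof (induction f rule: poly_mapping_add_induct)
    case zero
    then show ?case using hecke.subspace_0[OF V] by (simp add: zero_hecke_G7_def)
  next
    case (add f k c)
    obtain w where "k = GWord w" by (cases k)
    then have "abs_hecke_G7 (Poly_Mapping.single k c) =
        hecke_scale c (abs_hecke_G7 (Poly_Mapping.single (GWord w) 1))"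
      by (simp add: hecke_scale.abs_eq fconst_def mult_single)
    with add show ?case
      using word[of w] V
      by (simp add: hecke.subspace_add hecke.subspace_scale flip: plus_hecke_G7.abs_eq)
  qed
  then have "x \<in> V" for x by (induction x) simp
  then show ?thesis by auto
qed

section \<open>Centrality of \<open>z\<close> and usable forms of the defining relations\<close>

lemma hz_comm_gens: "hz * hs = hs * hz" "hz * ht = ht * hz" "hz * hu = hu * hz"
  using hecke_relations(1,2) by (metis hz_def mult.assoc)+

text \<open>The commutant of \<open>z\<close> is a submodule containing \<open>1\<close>; it is
  closed under prepending generators because each of them commutes with \<open>z\<close>.\<close>

lemma hz_central: "hz * x = x * hz"
proof -
  have "hecke.subspace {x. hz * x = x * hz}"
    unfolding hecke.subspace_def
    by (simp add: distrib_left distrib_right hecke_scale_mult_left hecke_scale_mult_right)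
  then have "{x. hz * x = x * hz} = UNIV"
    by (rule hecke_left_induct) (simp_all, (metis hz_comm_gens mult.assoc)+)
  then show ?thesis by auto
qed

lemma hz_power_central: "hz ^ k * x = x * hz ^ k"
  by (rule power_commuting_commutes) (rule hz_central)

lemma hs_eq: "hs = hz * hui * hti"
  by (simp add: hz_def word_simps)

lemma cubic_expand:
  assumes "(x - hpar p) * (x - hpar q) * (x - hpar r) = 0"
  shows "x * (x * x) = hecke_scale (par p + par q + par r) (x * x)
    - hecke_scale (par p * par q + par p * par r + par q * par r) x
    + hecke_scale (par p * par q * par r) 1"
  using assms
  by (simp add: algebra_simps hecke_scale_mult_left hecke_scale_mult_right
        hecke.scale_right_diff_distrib hecke.scale_right_distrib hecke.scale_left_distrib)

lemma scale_cubic_inverse: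
  assumes "(x - hpar p) * (x - hpar q) * (x - hpar r) = 0"
  shows "hecke_scale (par p * par q * par r) (minverse x) = x * x
    - hecke_scale (par p + par q + par r) x
    + hecke_scale (par p * par q + par p * par r + par q * par r) 1"
  using arg_cong[OF cubic_expand[OF assms], of "\<lambda>y. minverse x * y"] hecke_inverse[OF assms]
  by (simp add: distrib_left right_diff_distrib hecke_scale_mult_right flip: mult.assoc)

text \<open>This is the relation for \<open>s\<close> multiplied on the right by \<open>t u\<close>:
  here \<open>s t u = z\<close>, while \<open>s s t u = s z\<close> becomes the left side through
  \<open>s = z u^-1 t^-1\<close> and centrality.\<close>

lemma quadratic_relation:
  "hz * hz * (hui * hti) = hecke_scale (par Us1 + par Us2) hz - hecke_scale (par Us1 * par Us2) (ht * hu)"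
proof -
  have "hs * hs = hecke_scale (par Us1 + par Us2) hs - hecke_scale (par Us1 * par Us2) 1"
    using hecke_relations(3)
    by (simp add: algebra_simps hecke_scale_mult_left hecke_scale_mult_right
        hecke.scale_right_diff_distrib hecke.scale_right_distrib hecke.scale_left_distrib)
  then have "hs * hs * (ht * hu) = (hecke_scale (par Us1 + par Us2) hs - hecke_scale (par Us1 * par Us2) 1) * (ht * hu)"
    by simp
  moreover have "hs * hs * (ht * hu) = hz * hz * (hui * hti)"
    by (metis hz_def hs_eq hz_central mult.assoc)
  ultimately show ?thesis
    by (simp add: left_diff_distrib hecke_scale_mult_left hz_def mult.assoc)
qed


section \<open>Sums and products of submodules\<close>

lemma subspace_set_plus:
  assumes A: "hecke.subspace A" and B: "hecke.subspace B"
  shows "hecke.subspace (A + B)"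
proof (rule hecke.subspaceI)
  show "0 \<in> A + B"
    using set_plus_intro[of 0 A 0 B] A B by (simp add: hecke.subspace_0)
next
  fix x y assume "x \<in> A + B" "y \<in> A + B"
  then obtain a b a' b' where "x = a + b" "y = a' + b'" "a \<in> A" "b \<in> B" "a' \<in> A" "b' \<in> B"
    by (auto elim!: set_plus_elim)
  then have "x + y = (a + a') + (b + b')" "a + a' \<in> A" "b + b' \<in> B"
    using A B by (auto simp: ac_simps hecke.subspace_add)
  then show "x + y \<in> A + B" by auto
next
  fix c x assume "x \<in> A + B"
  then show "hecke_scale c x \<in> A + B"
    using A B
    by (auto elim!: set_plus_elim intro!: set_plus_intro
        simp: hecke.scale_right_distrib hecke.subspace_scale)
qed

lemma set_sum_least:
  assumes "hecke.subspace V" "\<And>k. k \<in> I \<Longrightarrow> S k \<subseteq> V"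
  shows "sum S I \<subseteq> V"
  using assms(2)
proof (induction I rule: infinite_finite_induct)
  case (insert k I)
  then have "S k \<subseteq> V" "sum S I \<subseteq> V" by simp_all
  with insert.hyps show ?case
    using hecke.subspace_add[OF assms(1)] by (auto elim!: set_plus_elim)
\<comment> \<open>For empty or infinite \<open>I\<close> the sum is the neutral set
  \<open>{0}\<close>.\<close>
qed (use hecke.subspace_0[OF assms(1)] in auto)

lemma subspace_set_sum:
  assumes "\<And>k. k \<in> I \<Longrightarrow> hecke.subspace (S k)"
  shows "hecke.subspace (sum S I)"
  using assms
proof (induction I rule: infinite_finite_induct)
  case (insert k I)
  then show ?case by (simp add: subspace_set_plus)
qed (simp_all add: hecke.subspace_single_0)

lemma subset_set_plus:
  assumes "0 \<in> B"
  shows "A \<subseteq> A + (B :: hecke_G7 set)" "A \<subseteq> B + A"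
  using assms set_plus_intro[of _ A 0 B] set_plus_intro[of 0 B _ A] by auto

lemma subset_set_sum:
  assumes "finite I" "k \<in> I" "\<And>k. k \<in> I \<Longrightarrow> hecke.subspace (S k)"
  shows "S k \<subseteq> sum S I"
proof -
  have "0 \<in> sum S (I - {k})"
    using assms(3) by (intro hecke.subspace_0 subspace_set_sum) auto
  then show ?thesis
    using subset_set_plus(1) by (metis assms(1,2) sum.remove)
qed

lemma subspace_span_mult: "hecke.subspace (X \<cdot>\<^sub>R Y)"
  by (simp add: span_mult_def)

lemma span_mult_intro: "x \<in> X \<Longrightarrow> y \<in> Y \<Longrightarrow> x * y \<in> X \<cdot>\<^sub>R Y"
  by (simp add: span_mult_def hecke.span_base set_times_intro)

lemma span_mult_least:
  assumes "hecke.subspace V" "\<And>x y. x \<in> X \<Longrightarrow> y \<in> Y \<Longrightarrow> x * y \<in> V"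
  shows "X \<cdot>\<^sub>R Y \<subseteq> V"
  unfolding span_mult_def
  by (rule hecke.span_minimal[OF _ assms(1)]) (auto elim!: set_times_elim intro: assms(2))

lemma subspace_right_quotient:
  assumes "hecke.subspace V"
  shows "hecke.subspace {x. x * y \<in> V}"
  using assms unfolding hecke.subspace_def
  by (simp add: distrib_right hecke_scale_mult_left)

lemma subspace_left_quotient:
  assumes "hecke.subspace V"
  shows "hecke.subspace {x. y * x \<in> V}"
  using assms unfolding hecke.subspace_def
  by (simp add: distrib_left hecke_scale_mult_right)

section \<open>Subalgebras, division by parameters, and the algebras generated by \<open>t\<close>
  and \<open>u\<close>\<close>

lemma subalgebra_hull:
  "is_subalgebra (is_subalgebra hull X)" "X \<subseteq> is_subalgebra hull X"
proof -
  show "is_subalgebra (is_subalgebra hull X)"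
    by (rule hull_in) (auto simp: is_subalgebra_def intro: hecke.subspace_Inter)
qed (rule hull_subset)

lemma scale_par_cancel:
  assumes V: "hecke.subspace V"
  shows "hecke_scale (par p * par q) x \<in> V \<Longrightarrow> x \<in> V"
    and "hecke_scale (par p * par q * par r) x \<in> V \<Longrightarrow> x \<in> V"
proof -
  have 1: "x \<in> V" if "hecke_scale (par p) x \<in> V" for p x
  proof -
    have "hecke_scale (par_inv p) (hecke_scale (par p) x) \<in> V"
      by (rule hecke.subspace_scale[OF V that])
    moreover have "par_inv p * par p = 1"
      using par_mult_par_inv by (simp add: mult.commute)
    ultimately show ?thesis by simp
  qed
  show "x \<in> V" if "hecke_scale (par p * par q) x \<in> V" for p q
    by (rule 1[of q], rule 1[of p]) (use that in simp)
  show "x \<in> V" if "hecke_scale (par p * par q * par r) x \<in> V"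
    by (rule 1[of r], rule 1[of q], rule 1[of p]) (use that in \<open>simp only: hecke.scale_scale mult.assoc\<close>)
qed

text \<open>Up to a unit of \<open>R\<close>, the inverse of \<open>x\<close> is a quadratic
  polynomial in \<open>x\<close>.\<close>

lemma subalgebra_inverse:
  assumes A: "is_subalgebra A" and "x \<in> A" "(x - hpar p) * (x - hpar q) * (x - hpar r) = 0"
  shows "minverse x \<in> A"
proof -
  have "hecke_scale (par p * par q * par r) (minverse x) \<in> A"
    unfolding scale_cubic_inverse[OF assms(3)] using assms(1,2) unfolding is_subalgebra_def
    by (intro hecke.subspace_scale hecke.subspace_add hecke.subspace_diff) auto
  then show ?thesis
    using A by (auto simp: is_subalgebra_def intro: scale_par_cancel(2))
qed

text \<open>Used twice: to bound \<open>subalgebra_u3\<close>, and to pass from \<open>t\<close>,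
  \<open>u\<close> to their inverses and to \<open>s\<close> when acting on
  \<open>hecke_U\<close>.\<close>

lemma is_subalgebra_stabiliser:
  assumes "hecke.subspace S"
  shows "is_subalgebra {y. \<forall>x\<in>S. y * x \<in> S}"
  using assms unfolding is_subalgebra_def hecke.subspace_def
  by (simp add: distrib_right hecke_scale_mult_left mult.assoc)

lemma subalgebra_u2: "is_subalgebra subalgebra_u2" "ht \<in> subalgebra_u2" "hti \<in> subalgebra_u2"
proof -
  show "is_subalgebra subalgebra_u2" "ht \<in> subalgebra_u2"
    using subalgebra_hull[of "{ht}"] by (auto simp: subalgebra_u2_def)
  then show "hti \<in> subalgebra_u2"
    by (rule subalgebra_inverse) (rule hecke_relations(4))
qed

lemma subalgebra_u3: "is_subalgebra subalgebra_u3" "hu \<in> subalgebra_u3" "hui \<in> subalgebra_u3"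
proof -
  show "is_subalgebra subalgebra_u3" "hu \<in> subalgebra_u3"
    using subalgebra_hull[of "{hu}"] by (auto simp: subalgebra_u3_def)
  then show "hui \<in> subalgebra_u3"
    by (rule subalgebra_inverse) (rule hecke_relations(5))
qed

text \<open>The stabiliser of the span is a subalgebra containing \<open>u\<close>, hence contains
  \<open>subalgebra_u3\<close>; applying it to \<open>1\<close> gives the claim.\<close>

lemma subalgebra_u3_subset_span: "subalgebra_u3 \<subseteq> hecke.span {1, hu, hui}"
proof -
  let ?S = "hecke.span {1, hu, hui}"
  define A where "A = {v. \<forall>x\<in>?S. v * x \<in> ?S}"
  \<comment> \<open>Written as \<open>u^3 u^-1\<close>, the square reduces by the cubic relation to
    \<open>u\<close>, \<open>1\<close> and \<open>u^-1\<close>.\<close>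
  have "hu * hu = hu * (hu * hu) * hui" by (simp add: word_simps)
  also have "\<dots> \<in> ?S"
    unfolding cubic_expand[OF hecke_relations(5)]
    by (simp add: left_diff_distrib distrib_right hecke_scale_mult_left word_simps
        hecke.span_add hecke.span_diff hecke.span_scale hecke.span_base)
  finally have "{1, hu, hui} \<subseteq> {x. hu * x \<in> ?S}"
    by (simp add: hecke.span_base hu_inverse)
  then have "hu \<in> A"
    unfolding A_def using hecke.span_minimal[OF _ subspace_left_quotient[OF hecke.subspace_span]]
    by blast
  moreover have "is_subalgebra A"
    unfolding A_def by (intro is_subalgebra_stabiliser hecke.subspace_span)
  ultimately have "subalgebra_u3 \<subseteq> A"
    unfolding subalgebra_u3_def by (intro hull_minimal) auto
  then show ?thesis
    by (auto simp: A_def hecke.span_base dest!: subsetD bspec[where x = 1])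
qed


section \<open>The module \<open>U\<close>\<close>

lemma subspace_hecke_U: "hecke.subspace hecke_U"
  unfolding hecke_U_def by (intro subspace_set_sum subspace_set_plus subspace_span_mult)

lemma hecke_U_intros:
  assumes "k \<le> 11" "m \<in> subalgebra_u2"
  shows "v \<in> subalgebra_u3 \<Longrightarrow> hz ^ k * v * m \<in> hecke_U"
    and "hz ^ k * ht * hui * m \<in> hecke_U"
proof -
  let ?A = "{hz ^ k} \<cdot>\<^sub>R subalgebra_u3 \<cdot>\<^sub>R subalgebra_u2"
    and ?B = "{hz ^ k * ht * minverse hu} \<cdot>\<^sub>R subalgebra_u2"
  have sub: "?A + ?B \<subseteq> hecke_U"
    unfolding hecke_U_def using assms(1)
    by (intro subset_set_sum[where k = k
          and S = "\<lambda>k. {hz ^ k} \<cdot>\<^sub>R subalgebra_u3 \<cdot>\<^sub>R subalgebra_u2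
            + {hz ^ k * ht * minverse hu} \<cdot>\<^sub>R subalgebra_u2"]
        subspace_set_plus subspace_span_mult) auto
  have "?A \<subseteq> ?A + ?B" "?B \<subseteq> ?A + ?B"
    by (intro subset_set_plus hecke.subspace_0 subspace_span_mult)+
  with sub have AB: "?A \<subseteq> hecke_U" "?B \<subseteq> hecke_U" by auto
  show "hz ^ k * v * m \<in> hecke_U" if "v \<in> subalgebra_u3"
    using AB(1) that assms(2) by (auto intro!: span_mult_intro)
  show "hz ^ k * ht * hui * m \<in> hecke_U"
    using AB(2) assms(2) by (auto intro!: span_mult_intro)
qed

text \<open>With \<open>hecke_U_intros\<close> this presents \<open>hecke_U\<close> by generators,
  so the nested spans and the set sum need not be unfolded again.\<close>

lemma hecke_U_least:
  assumes V: "hecke.subspace V"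
    and "\<And>k v m. k \<le> 11 \<Longrightarrow> v \<in> subalgebra_u3 \<Longrightarrow> m \<in> subalgebra_u2 \<Longrightarrow> hz ^ k * v * m \<in> V"
    and "\<And>k m. k \<le> 11 \<Longrightarrow> m \<in> subalgebra_u2 \<Longrightarrow> hz ^ k * ht * hui * m \<in> V"
  shows "hecke_U \<subseteq> V"
  unfolding hecke_U_def
proof (intro set_sum_least V)
  fix k :: nat
  assume "k \<in> {0..11}"
  then have k: "k \<le> 11" by simp
  \<comment> \<open>The inner factor is itself a span, so \<open>m\<close> is fixed first and the
    span is tested inside a right quotient of \<open>V\<close>.\<close>
  have "{hz ^ k} \<cdot>\<^sub>R subalgebra_u3 \<subseteq> {x. x * m \<in> V}" if "m \<in> subalgebra_u2" for m
    using assms(2) k that by (intro span_mult_least subspace_right_quotient V) auto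
  then have "{hz ^ k} \<cdot>\<^sub>R subalgebra_u3 \<cdot>\<^sub>R subalgebra_u2 \<subseteq> V"
    by (intro span_mult_least V) auto
  moreover have "{hz ^ k * ht * hui} \<cdot>\<^sub>R subalgebra_u2 \<subseteq> V"
    using assms(3) k by (intro span_mult_least V) auto
  ultimately show "{hz ^ k} \<cdot>\<^sub>R subalgebra_u3 \<cdot>\<^sub>R subalgebra_u2
      + {hz ^ k * ht * hui} \<cdot>\<^sub>R subalgebra_u2 \<subseteq> V"
    using hecke.subspace_add[OF V] by (auto elim!: set_plus_elim)
qed

lemma hecke_U_right:
  assumes "x \<in> hecke_U" "m \<in> subalgebra_u2"
  shows "x * m \<in> hecke_U"
proof -
  have "m' * m \<in> subalgebra_u2" if "m' \<in> subalgebra_u2" for m'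
    using subalgebra_u2(1) that assms(2) by (simp add: is_subalgebra_def)
  then have "hecke_U \<subseteq> {x. x * m \<in> hecke_U}"
    using hecke_U_intros
    by (intro hecke_U_least subspace_right_quotient subspace_hecke_U) (auto simp: mult.assoc)
  with assms(1) show ?thesis by auto
qed

section \<open>Words tracked with intervals of exponents of \<open>z\<close>\<close>

text \<open>Stability of \<open>hecke_U\<close> under \<open>z\<close> is only known at the end, so
  membership of a word is recorded together with the powers of \<open>z\<close> for which it
  holds.\<close>

definition in_strip :: "nat \<Rightarrow> nat \<Rightarrow> hecke_G7 \<Rightarrow> bool" where
  "in_strip a b x \<longleftrightarrow> (\<forall>k\<in>{a..b}. hz ^ k * x \<in> hecke_U)"

lemma in_strip_right:
  assumes "in_strip a b x"
  shows "in_strip a b (x * ht)" "in_strip a b (x * hti)"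
  using assms hecke_U_right subalgebra_u2 unfolding in_strip_def
  by (metis mult.assoc)+

lemma in_strip_u3:
  assumes "v \<in> subalgebra_u3"
  shows "in_strip 0 11 v"
  using hecke_U_intros(1)[OF _ _ assms, where m = 1] subalgebra_u2(1)
  by (auto simp: in_strip_def is_subalgebra_def)

lemma in_strip_t_hui: "in_strip 0 11 (ht * hui)"
  using hecke_U_intros(2)[where m = 1] subalgebra_u2(1)
  by (auto simp: in_strip_def is_subalgebra_def mult.assoc)

lemma in_strip_mono: "in_strip a b x \<Longrightarrow> a \<le> a' \<Longrightarrow> b' \<le> b \<Longrightarrow> in_strip a' b' x"
  by (auto simp: in_strip_def)

text \<open>Between \<open>l\<close> and \<open>m\<close> the cubic relation links
  \<open>x^-1\<close>, \<open>1\<close>, \<open>x\<close>, \<open>x^2\<close>. Its extreme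
  coefficients are units, so either extreme word follows from the other three.\<close>

lemma in_strip_cubic:
  assumes cubic: "(x - hpar p) * (x - hpar q) * (x - hpar r) = 0"
  shows "in_strip a b (l * (minverse x * m)) \<Longrightarrow> in_strip a b (l * m)
      \<Longrightarrow> in_strip a b (l * (x * m)) \<Longrightarrow> in_strip a b (l * (x * (x * m)))"
    and "in_strip a b (l * m) \<Longrightarrow> in_strip a b (l * (x * m))
      \<Longrightarrow> in_strip a b (l * (x * (x * m))) \<Longrightarrow> in_strip a b (l * (minverse x * m))"
proof -
  let ?d = "par p * par q * par r"
  have e: "hz ^ k * (l * (x * (x * m))) = hecke_scale (par p + par q + par r) (hz ^ k * (l * (x * m)))
    - hecke_scale (par p * par q + par p * par r + par q * par r) (hz ^ k * (l * m))
    + hecke_scale ?d (hz ^ k * (l * (minverse x * m)))" for k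
    using arg_cong[OF scale_cubic_inverse[OF cubic], of "\<lambda>y. hz ^ k * l * y * m"]
    by (simp add: algebra_simps hecke_scale_mult_right hecke_scale_mult_left)
  show "in_strip a b (l * (x * (x * m)))"
    if "in_strip a b (l * (minverse x * m))" "in_strip a b (l * m)" "in_strip a b (l * (x * m))"
    using that subspace_hecke_U unfolding in_strip_def e
    by (intro ballI hecke.subspace_add hecke.subspace_diff hecke.subspace_scale) auto
  show "in_strip a b (l * (minverse x * m))"
    if "in_strip a b (l * m)" "in_strip a b (l * (x * m))" "in_strip a b (l * (x * (x * m)))"
    unfolding in_strip_def
  proof
    fix k
    assume k: "k \<in> {a..b}"
    have "hecke_scale ?d (hz ^ k * (l * (minverse x * m))) = hz ^ k * (l * (x * (x * m)))
      - hecke_scale (par p + par q + par r) (hz ^ k * (l * (x * m)))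
      + hecke_scale (par p * par q + par p * par r + par q * par r) (hz ^ k * (l * m))"
      by (simp add: e)
    also have "\<dots> \<in> hecke_U"
      using that subspace_hecke_U k unfolding in_strip_def
      by (intro hecke.subspace_add hecke.subspace_diff hecke.subspace_scale) auto
    finally show "hz ^ k * (l * (minverse x * m)) \<in> hecke_U"
      by (rule scale_par_cancel(2)[OF subspace_hecke_U])
  qed
qed

text \<open>The three terms carry consecutive powers of \<open>z\<close>; this is the source of the
  shifts by 1 and 2 in \<open>z_up\<close> and \<open>z_down\<close>.\<close>

lemma quadratic_relation_word:
  "hz ^ (k + 2) * (l * (hui * (hti * m))) =
    hecke_scale (par Us1 + par Us2) (hz ^ (k + 1) * (l * m))
    - hecke_scale (par Us1 * par Us2) (hz ^ k * (l * (ht * (hu * m))))"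
proof -
  have l: "hz * (l * y) = l * (hz * y)" for y
    by (metis hz_central mult.assoc)
  have "hz ^ (k + 2) * (l * (hui * (hti * m))) = hz ^ k * (l * (hz * hz * (hui * hti) * m))"
    by (simp only: power_add power2_eq_square mult.assoc l)
  also have "\<dots> = hz ^ k * (l * ((hecke_scale (par Us1 + par Us2) hz
    - hecke_scale (par Us1 * par Us2) (ht * hu)) * m))"
    by (simp only: quadratic_relation)
  also have "\<dots> = hecke_scale (par Us1 + par Us2) (hz ^ k * (l * (hz * m)))
    - hecke_scale (par Us1 * par Us2) (hz ^ k * (l * (ht * (hu * m))))"
    by (simp add: right_diff_distrib left_diff_distrib
        hecke_scale_mult_right hecke_scale_mult_left mult.assoc)
  also have "hz ^ k * (l * (hz * m)) = hz ^ (k + 1) * (l * m)"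
    by (simp only: power_add power_one_right mult.assoc l)
  finally show ?thesis .
qed

text \<open>The words are tied to their factorisations by separate equations, so that a use supplies
  only \<open>l\<close> and \<open>m\<close> and cancellation is left to simp. The bounds place
  \<open>{a..b}\<close> inside all three strips.\<close>

lemma in_strip_cubic_up:
  assumes "(x - hpar p) * (x - hpar q) * (x - hpar r) = 0"
    and "in_strip a1 b1 w1" "in_strip a2 b2 w2" "in_strip a3 b3 w3"
    and "w1 = l * (minverse x * m)" "w2 = l * m" "w3 = l * (x * m)" "w = l * (x * (x * m))"
    and "a1 \<le> a" "a2 \<le> a" "a3 \<le> a" "b \<le> b1" "b \<le> b2" "b \<le> b3"
  shows "in_strip a b w"
  using assms(2-4)[THEN in_strip_mono[where a' = a and b' = b]] assms(9-)
    in_strip_cubic(1)[OF assms(1)] unfolding assms(5-8) by simp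

lemma in_strip_cubic_down:
  assumes "(x - hpar p) * (x - hpar q) * (x - hpar r) = 0"
    and "in_strip a1 b1 w1" "in_strip a2 b2 w2" "in_strip a3 b3 w3"
    and "w1 = l * m" "w2 = l * (x * m)" "w3 = l * (x * (x * m))" "w = l * (minverse x * m)"
    and "a1 \<le> a" "a2 \<le> a" "a3 \<le> a" "b \<le> b1" "b \<le> b2" "b \<le> b3"
  shows "in_strip a b w"
  using assms(2-4)[THEN in_strip_mono[where a' = a and b' = b]] assms(9-)
    in_strip_cubic(2)[OF assms(1)] unfolding assms(5-8) by simp

lemmas t_up = in_strip_cubic_up[OF hecke_relations(4)]
  and t_down = in_strip_cubic_down[OF hecke_relations(4)]
  and u_up = in_strip_cubic_up[OF hecke_relations(5)]
  and u_down = in_strip_cubic_down[OF hecke_relations(5)]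

lemma quadratic_up:
  assumes "hz ^ k * (l * (ht * (hu * m))) \<in> hecke_U" "hz ^ (k + 1) * (l * m) \<in> hecke_U"
  shows "hz ^ (k + 2) * (l * (hui * (hti * m))) \<in> hecke_U"
  unfolding quadratic_relation_word
  by (intro hecke.subspace_diff hecke.subspace_scale subspace_hecke_U assms)

lemma quadratic_down:
  assumes "hz ^ (k + 2) * (l * (hui * (hti * m))) \<in> hecke_U" "hz ^ (k + 1) * (l * m) \<in> hecke_U"
  shows "hz ^ k * (l * (ht * (hu * m))) \<in> hecke_U"
proof -
  have "hecke_scale (par Us1 * par Us2) (hz ^ k * (l * (ht * (hu * m)))) =
      hecke_scale (par Us1 + par Us2) (hz ^ (k + 1) * (l * m))
      - hz ^ (k + 2) * (l * (hui * (hti * m)))"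
    unfolding quadratic_relation_word by simp
  also have "\<dots> \<in> hecke_U"
    by (intro hecke.subspace_diff hecke.subspace_scale subspace_hecke_U assms)
  finally show ?thesis by (rule scale_par_cancel(1)[OF subspace_hecke_U])
qed

lemma z_up:
  assumes "in_strip a1 b1 w1" "in_strip a2 b2 w2"
    and w: "w1 = l * (ht * (hu * m))" "w2 = l * m" "w = l * (hui * (hti * m))"
    and "2 \<le> a" "a1 + 2 \<le> a" "a2 + 1 \<le> a" "b \<le> b1 + 2" "b \<le> b2 + 1"
  shows "in_strip a b w"
  unfolding in_strip_def
proof
  fix k
  assume "k \<in> {a..b}"
  then obtain i where i: "k = i + 2" "i \<in> {a1..b1}" "i + 1 \<in> {a2..b2}"
    using assms(6-) le_Suc_ex[of 2 k] by (auto simp: add.commute)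
  then show "hz ^ k * w \<in> hecke_U"
    using assms(1,2) quadratic_up[of i l m] unfolding in_strip_def w by blast
qed

lemma z_down:
  assumes "in_strip a1 b1 w1" "in_strip a2 b2 w2"
    and w: "w1 = l * (hui * (hti * m))" "w2 = l * m" "w = l * (ht * (hu * m))"
    and "a1 \<le> a + 2" "a2 \<le> a + 1" "b + 2 \<le> b1" "b + 1 \<le> b2"
  shows "in_strip a b w"
  unfolding in_strip_def
proof
  fix k
  assume "k \<in> {a..b}"
  then have "k + 2 \<in> {a1..b1}" "k + 1 \<in> {a2..b2}" using assms(6-) by auto
  then show "hz ^ k * w \<in> hecke_U"
    using assms(1,2) quadratic_down[of k l m] unfolding in_strip_def w by blast
qed

text \<open>Adjacent strips suffice, such as 0 to 9 and 10 to 11; no overlap is required.\<close>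

lemma in_strip_join:
  "in_strip a b x \<Longrightarrow> in_strip a' b' x \<Longrightarrow> a' \<le> Suc b \<Longrightarrow> in_strip a b' x"
  by (fastforce simp: in_strip_def)

text \<open>
  In the proof, \<open>ti\<close> and \<open>ui\<close> in fact names stand for the inverses, and primed facts are
  a second strip for the same word. The chain of relations was found by a computer search.
\<close>

lemma in_strip_words:
  "in_strip 0 11 (ht * hu)" "in_strip 0 11 (hti * hui)" "in_strip 0 11 (hu * ht * hui)"
proof -
  have closed: "1 \<in> subalgebra_u3" "hu * hu \<in> subalgebra_u3" "hui * hui \<in> subalgebra_u3"
    using subalgebra_u3 by (auto simp: is_subalgebra_def)
  note base_1 = in_strip_u3[OF closed(1)] and base_u = in_strip_u3[OF subalgebra_u3(2)]
    and base_ui = in_strip_u3[OF subalgebra_u3(3)] and base_uu = in_strip_u3[OF closed(2)]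
    and base_uiui = in_strip_u3[OF closed(3)] and base_tui = in_strip_t_hui
  \<comment> \<open>Between \<open>u\<close> and \<open>u^-1\<close> the three words of the
    quadratic relation collapse to \<open>u t\<close>, \<open>1\<close> and
    \<open>t^-1 u^-1\<close>. Exponents 0 and 1 remain open until \<open>tiui'\<close>.\<close>
  have tiui: "in_strip 2 11 (hti * hui)"
    by (rule z_up[OF base_u[THEN in_strip_right(1)] base_1, of "hu" "hui"]) (simp_all add: word_simps)
  have tu: "in_strip 0 9 (ht * hu)"
    by (rule z_down[OF base_ui[THEN in_strip_right(2)] base_1, of "1" "1"]) (simp_all add: word_simps)
  have tu2: "in_strip 0 9 (ht * hu * hu)"
    by (rule u_up[OF base_tui base_1[THEN in_strip_right(1)] tu, of "ht" "1"]) (simp_all add: word_simps)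
  have tutiui: "in_strip 2 10 (ht * hu * hti * hui)"
    by (rule z_up[OF tu2[THEN in_strip_right(1)] tu, of "ht * hu * hu" "hui"]) (simp_all add: word_simps)
  have utiui: "in_strip 2 11 (hu * hti * hui)"
    by (rule z_up[OF base_uu[THEN in_strip_right(1)] base_u, of "hu * hu" "hui"]) (simp_all add: word_simps)
  have tutui: "in_strip 0 9 (ht * hu * ht * hui)"
    by (rule z_down[OF base_uiui base_tui, of "1" "ht * hui"]) (simp_all add: word_simps)
  have tuti2ui: "in_strip 2 9 (ht * hu * hti * hti * hui)"
    by (rule t_down[OF tutiui base_1[THEN in_strip_right(1)] tutui, of "ht * hu" "hti * hui"]) (simp_all add: word_simps)
  have tut2ui: "in_strip 2 9 (ht * hu * ht * ht * hui)"
    by (rule t_up[OF tutiui base_1[THEN in_strip_right(1)] tutui, of "ht * hu" "hui"]) (simp_all add: word_simps)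
  have t2ui: "in_strip 2 11 (ht * ht * hui)"
    by (rule t_up[OF tiui base_ui base_tui, of "1" "hui"]) (simp_all add: word_simps)
  have uitui: "in_strip 4 11 (hui * ht * hui)"
    by (rule z_up[OF tut2ui t2ui, of "1" "ht * ht * hui"]) (simp_all add: word_simps)
  have ti2ui: "in_strip 2 11 (hti * hti * hui)"
    by (rule t_down[OF tiui base_ui base_tui, of "1" "hti * hui"]) (simp_all add: word_simps)
  have tiu: "in_strip 0 9 (hti * hu)"
    by (rule z_down[OF ti2ui[THEN in_strip_right(2)] base_1[THEN in_strip_right(2), THEN in_strip_right(2)], of "hti * hti" "1"]) (simp_all add: word_simps)
  have tiui2: "in_strip 2 9 (hti * hui * hui)"
    by (rule u_down[OF tiui base_1[THEN in_strip_right(2)] tiu, of "hti" "hui"]) (simp_all add: word_simps)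
  have utui: "in_strip 0 7 (hu * ht * hui)"
    by (rule z_down[OF tiui2 base_ui, of "hu" "hui * hui"]) (simp_all add: word_simps)
  \<comment> \<open>Start of the climb to exponents 8 to 11 of \<open>u t u^-1\<close>:
    \<open>z_up\<close> carries 4 to 7 into 6 to 9 at \<open>utiui2\<close> and into 8 to 11 at
    \<open>uti2ui\<close>, with cubic relations changing the words in between and at the
    end.\<close>
  have u2tui: "in_strip 4 7 (hu * hu * ht * hui)"
    by (rule u_up[OF uitui base_tui utui, of "1" "ht * hui"]) (simp_all add: word_simps)
  have tutiu: "in_strip 0 7 (ht * hu * hti * hu)"
    by (rule z_down[OF tuti2ui[THEN in_strip_right(2)] tu[THEN in_strip_right(2), THEN in_strip_right(2)], of "ht * hu * hti * hti" "1"]) (simp_all add: word_simps)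
  have tiu2: "in_strip 2 9 (hti * hu * hu)"
    by (rule u_up[OF tiui base_1[THEN in_strip_right(2)] tiu, of "hti" "1"]) (simp_all add: word_simps)
  have utiui2: "in_strip 6 9 (hu * hti * hui * hui)"
    by (rule z_up[OF u2tui base_1, of "hu * hu" "hui * hui"]) (simp_all add: word_simps)
  have utiu: "in_strip 6 9 (hu * hti * hu)"
    by (rule u_up[OF utiui2 utiui base_u[THEN in_strip_right(2)], of "hu * hti" "hui"]) (simp_all add: word_simps)
  have uti2ui: "in_strip 8 11 (hu * hti * hti * hui)"
    by (rule z_up[OF utiu[THEN in_strip_right(1)] base_u[THEN in_strip_right(2)], of "hu * hti * hu" "hui"]) (simp_all add: word_simps)
  have utui': "in_strip 8 11 (hu * ht * hui)"
    by (rule t_up[OF uti2ui utiui base_1, of "hu" "hti * hui"]) (simp_all add: word_simps)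
  have tui2: "in_strip 0 9 (ht * hui * hui)"
    by (rule u_down[OF base_tui base_1[THEN in_strip_right(1)] tu, of "ht" "hui"]) (simp_all add: word_simps)
  have t2utui: "in_strip 1 7 (ht * ht * hu * ht * hui)"
    by (rule z_down[OF tui2 t2ui, of "ht" "ht * hui"]) (simp_all add: word_simps)
  have ut2ui: "in_strip 2 7 (hu * ht * ht * hui)"
    by (rule t_up[OF utiui base_1 utui, of "hu" "hui"]) (simp_all add: word_simps)
  have tiuitui: "in_strip 4 9 (hti * hui * ht * hui)"
    by (rule z_up[OF ut2ui base_tui, of "hu" "hui * ht * hui"]) (simp_all add: word_simps)
  have tutiui2: "in_strip 2 7 (ht * hu * hti * hui * hui)"
    by (rule u_down[OF tutiui tu[THEN in_strip_right(2)] tutiu, of "ht * hu * hti" "hui"]) (simp_all add: word_simps)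
  have tu2tui: "in_strip 0 5 (ht * hu * hu * ht * hui)"
    by (rule z_down[OF tutiui2 base_1[THEN in_strip_right(1)], of "ht * hu * hu" "hui * hui"]) (simp_all add: word_simps)
  have tiutui: "in_strip 1 7 (hti * hu * ht * hui)"
    by (rule t_down[OF utui tutui t2utui, of "1" "hu * ht * hui"]) (simp_all add: word_simps)
  \<comment> \<open>The same climb with \<open>t^-1\<close> in front, ending at
    \<open>tiutui'\<close>.\<close>
  have tiu2tui: "in_strip 4 7 (hti * hu * hu * ht * hui)"
    by (rule u_up[OF tiuitui base_ui tiutui, of "hti" "ht * hui"]) (simp_all add: word_simps)
  have tiutiui2: "in_strip 6 9 (hti * hu * hti * hui * hui)"
    by (rule z_up[OF tiu2tui base_1[THEN in_strip_right(2)], of "hti * hu * hu" "hui * hui"]) (simp_all add: word_simps)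
  have tiutiui: "in_strip 4 10 (hti * hu * hti * hui)"
    by (rule z_up[OF tiu2[THEN in_strip_right(1)] tiu, of "hti * hu * hu" "hui"]) (simp_all add: word_simps)
  have tiutiu: "in_strip 6 9 (hti * hu * hti * hu)"
    by (rule u_up[OF tiutiui2 tiutiui tiu[THEN in_strip_right(2)], of "hti * hu * hti" "hui"]) (simp_all add: word_simps)
  have tiuti2ui: "in_strip 8 10 (hti * hu * hti * hti * hui)"
    by (rule z_up[OF tiutiu[THEN in_strip_right(1)] tiu[THEN in_strip_right(2)], of "hti * hu * hti * hu" "hui"]) (simp_all add: word_simps)
  have tiutui': "in_strip 8 10 (hti * hu * ht * hui)"
    by (rule t_up[OF tiuti2ui tiutiui base_1[THEN in_strip_right(2)], of "hti * hu" "hti * hui"]) (simp_all add: word_simps)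
  \<comment> \<open>The leading \<open>t^-1\<close> is traded for \<open>t^2\<close>;
    \<open>z_up\<close> then reaches \<open>t u^-2\<close> at exponents 10 and 11, and the cubic
    relation of \<open>u\<close> gives the missing part of \<open>t u\<close>.\<close>
  have t2utui': "in_strip 8 9 (ht * ht * hu * ht * hui)"
    by (rule t_up[OF tiutui' utui' tutui, of "1" "hu * ht * hui"]) (simp_all add: word_simps)
  have tui2': "in_strip 10 11 (ht * hui * hui)"
    by (rule z_up[OF t2utui' t2ui, of "ht" "ht * hui"]) (simp_all add: word_simps)
  have tu': "in_strip 10 11 (ht * hu)"
    by (rule u_up[OF tui2' base_tui base_1[THEN in_strip_right(1)], of "ht" "hui"]) (simp_all add: word_simps)
  \<comment> \<open>Start of the descent to exponents 0 and 1 of \<open>t^-1 u^-1\<close>: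
    \<open>z_down\<close> carries 4 and 5 to 2 and 3 at \<open>tiut2ui\<close>, then to 0 and 1 at
    \<open>tiu2'\<close>.\<close>
  have tuitui: "in_strip 2 5 (ht * hui * ht * hui)"
    by (rule u_down[OF t2ui tutui tu2tui, of "ht" "ht * hui"]) (simp_all add: word_simps)
  have ti2uitui: "in_strip 4 5 (hti * hti * hui * ht * hui)"
    by (rule t_down[OF tiuitui uitui tuitui, of "1" "hti * hui * ht * hui"]) (simp_all add: word_simps)
  have tiut2ui: "in_strip 2 3 (hti * hu * ht * ht * hui)"
    by (rule z_down[OF ti2uitui base_ui, of "hti * hu" "hui * ht * hui"]) (simp_all add: word_simps)
  have tiutiui': "in_strip 2 3 (hti * hu * hti * hui)"
    by (rule t_down[OF base_1[THEN in_strip_right(2)] tiutui tiut2ui, of "hti * hu" "hui"]) (simp_all add: word_simps)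
  have tiu2': "in_strip 0 1 (hti * hu * hu)"
    by (rule z_down[OF tiutiui'[THEN in_strip_right(2)] tiu[THEN in_strip_right(2)], of "hti * hu * hti" "1"]) (simp_all add: word_simps)
  have tiui': "in_strip 0 1 (hti * hui)"
    by (rule u_down[OF base_1[THEN in_strip_right(2)] tiu tiu2', of "hti" "1"]) (simp_all add: word_simps)
  show "in_strip 0 11 (ht * hu)" "in_strip 0 11 (hti * hui)" "in_strip 0 11 (hu * ht * hui)"
    using in_strip_join[OF tu tu'] in_strip_join[OF tiui' tiui] in_strip_join[OF utui utui']
    by simp_all
qed


section \<open>\<open>U\<close> is a left ideal\<close>

text \<open>As \<open>z\<close> is central and \<open>hecke_U\<close> is a right
  \<open>subalgebra_u2\<close>-module, left multiplication by \<open>y\<close> need only be tested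
  on \<open>1\<close>, \<open>u\<close>, \<open>u^-1\<close> and \<open>t u^-1\<close>.\<close>

lemma hecke_U_left:
  assumes "in_strip 0 11 y" "in_strip 0 11 (y * hu)" "in_strip 0 11 (y * hui)"
    "in_strip 0 11 (y * (ht * hui))" "x \<in> hecke_U"
  shows "y * x \<in> hecke_U"
proof -
  have comm: "y * (hz ^ k * w) = hz ^ k * (y * w)" for k w
    by (metis hz_power_central mult.assoc)
  have "hecke_U \<subseteq> {x. y * x \<in> hecke_U}"
  proof (intro hecke_U_least subspace_left_quotient subspace_hecke_U)
    fix k v m
    assume k: "k \<le> (11::nat)" and v: "v \<in> subalgebra_u3" and m: "m \<in> subalgebra_u2"
    have "hecke.span {1, hu, hui} \<subseteq> {v. hz ^ k * y * v \<in> hecke_U}"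
      using assms(1-3) k
      by (intro hecke.span_minimal subspace_left_quotient subspace_hecke_U)
        (auto simp: in_strip_def mult.assoc)
    then have "hz ^ k * y * v \<in> hecke_U"
      using subalgebra_u3_subset_span v by auto
    then have "hz ^ k * y * v * m \<in> hecke_U"
      using m by (rule hecke_U_right)
    then show "hz ^ k * v * m \<in> {x. y * x \<in> hecke_U}"
      by (simp add: mult.assoc comm)
  next
    fix k m
    assume k: "k \<le> (11::nat)" and m: "m \<in> subalgebra_u2"
    have "hz ^ k * (y * (ht * hui)) \<in> hecke_U"
      using assms(4) k by (simp add: in_strip_def)
    then have "hz ^ k * (y * (ht * hui)) * m \<in> hecke_U"
      using m by (rule hecke_U_right)
    then show "hz ^ k * ht * hui * m \<in> {x. y * x \<in> hecke_U}"
      by (simp add: mult.assoc comm)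
  qed
  with assms(5) show ?thesis by auto
qed

text \<open>Multiplication by \<open>z\<close> shifts the exponents by one, so 12 is the only new
  one.\<close>

lemma in_strip_hz:
  assumes "in_strip 0 11 x" "hz ^ 12 * x \<in> hecke_U"
  shows "in_strip 0 11 (hz * x)"
  unfolding in_strip_def
proof
  fix k :: nat
  assume "k \<in> {0..11}"
  then have "k + 1 \<le> 11 \<or> k + 1 = 12" by auto
  then have "hz ^ (k + 1) * x \<in> hecke_U"
    using assms by (auto simp: in_strip_def simp del: power_Suc)
  then show "hz ^ k * (hz * x) \<in> hecke_U"
    by (simp only: power_add power_one_right mult.assoc)
qed

lemma hecke_U_eq_UNIV: "hecke_U = UNIV"
proof -
  let ?A = "{y. \<forall>x\<in>hecke_U. y * x \<in> hecke_U}"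
  have A: "is_subalgebra ?A"
    by (intro is_subalgebra_stabiliser subspace_hecke_U)
  have "1 \<in> subalgebra_u3" "hu * hu \<in> subalgebra_u3"
    using subalgebra_u3 by (auto simp: is_subalgebra_def)
  note u3 = this[THEN in_strip_u3] subalgebra_u3(2,3)[THEN in_strip_u3]
  have t: "in_strip 0 11 ht" "in_strip 0 11 hti"
    using in_strip_right[OF u3(1)] by simp_all
  \<comment> \<open>The cubic relation of \<open>t\<close> reduces this to \<open>t^-1 u^-1\<close>,
    \<open>u^-1\<close> and \<open>t u^-1\<close>.\<close>
  have "in_strip 0 11 (ht * (ht * hui))"
    by (rule t_up[OF in_strip_words(2) u3(4) in_strip_t_hui, of 1 hui]) simp_all
  then have ht: "ht \<in> ?A"
    using hecke_U_left[of ht] t in_strip_words in_strip_t_hui by simp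
  have hu: "hu \<in> ?A"
    using hecke_U_left[of hu] u3 in_strip_words by (simp add: hu_inverse mult.assoc)
  have inv: "hti \<in> ?A" "hui \<in> ?A"
    by (rule subalgebra_inverse[OF A ht hecke_relations(4)] subalgebra_inverse[OF A hu hecke_relations(5)])+
  \<comment> \<open>At \<open>k = 10\<close> the other two terms are \<open>z^10 t u\<close> and
    \<open>z^11\<close>, both available. The factors \<open>t^-1\<close> and \<open>u^-1\<close> are
    then removed by \<open>t\<close> on the right and \<open>u\<close> on the left.\<close>
  have "hz ^ (10 + 2) * (1 * (hui * (hti * 1))) \<in> hecke_U"
    by (rule quadratic_up) (use in_strip_words(1) u3(1) in \<open>simp_all add: in_strip_def\<close>)
  then have "hz ^ 12 * hui * hti \<in> hecke_U"
    by (simp add: mult.assoc)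
  then have "hz ^ 12 * hui * hti * ht \<in> hecke_U"
    by (rule hecke_U_right) (rule subalgebra_u2)
  then have "hu * (hz ^ 12 * hui) \<in> hecke_U"
    using hu by (simp add: word_simps)
  then have z12: "hz ^ 12 \<in> hecke_U"
    by (simp add: word_simps hz_power_central[of 12])
  \<comment> \<open>By centrality this is \<open>y z^12\<close>, which is \<open>y\<close> applied
    to an element of \<open>hecke_U\<close>; it supplies exponent 12 for all four test
    words.\<close>
  have z12A: "hz ^ 12 * y \<in> hecke_U" if "y \<in> ?A" for y
    using that z12 hz_power_central[of 12 y] by auto
  have "ht * hui \<in> ?A"
    using A ht inv unfolding is_subalgebra_def by blast
  then have strip: "in_strip 0 11 (hz * y)" if "y \<in> {1, hu, hui, ht * hui}" for y
    using that z12 z12A ht hu inv u3 in_strip_t_hui by (auto intro!: in_strip_hz)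
  then have "hz \<in> ?A"
    using hecke_U_left[of hz] strip[of 1] strip[of hu] strip[of hui] strip[of "ht * hui"] by simp
  then have hs: "hs \<in> ?A"
    using A inv unfolding hs_eq is_subalgebra_def by blast
  have "1 \<in> hecke_U"
    using u3(1) by (force simp: in_strip_def)
  then show ?thesis
    using ht hu hs by (intro hecke_left_induct subspace_hecke_U) auto
qed

theorem theorem4p2p13:
  shows "(UNIV :: hecke_G7 set) =
    (\<Sum>k = 0..(11::nat).
        {hz ^ k} \<cdot>\<^sub>R subalgebra_u3 \<cdot>\<^sub>R subalgebra_u2
      + {hz ^ k * ht * minverse hu} \<cdot>\<^sub>R subalgebra_u2)"
  using hecke_U_eq_UNIV unfolding hecke_U_def by simp

end
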